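(* For each integer $N \geq 2$, there is an algebraic and non-rational proper holomorphic map from the unit disk $\Delta$ to the complex unit ball $\mathbb{B}^N$ that extends holomorphically to a neighborhood of the closed unit disk $\overline{\Delta}$.
   Context: $\Delta=\{w\in\mathbb{C}: |w|<1\}$ and $\mathbb{B}^N=\{z\in\mathbb{C}^N:\|z\|<1\}$, with $\|\cdot\|$ the Euclidean norm. A holomorphic map $F=(F_1,\ldots,F_N):\Delta\to\mathbb{C}^N$ is algebraic if each component $F_j$ is an algebraic function of $w$, i.e. there is a nonzero polynomial $P_j(w,x)\in\mathbb{C}[w,x]$ with $P_j(w,F_j(w))=0$ for all $w\in\Delta$. The map is rational if every component $F_j$ is the restriction of a rational function of $w$; it is non-rational otherwise. *)

theory Defs
  imports "HOL-Analysis.Analysis" "HOL-Computational_Algebra.Polynomial"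
begin

text \<open>
  The norm of \<^typ>\<open>complex ^ 'n\<close> is the Euclidean one, so \<^term>\<open>ball (0 :: complex ^ 'n) 1\<close>
  is the complex unit ball. The constant \<^const>\<open>holomorphic_on\<close> is restricted to scalar
  functions, hence the componentwise notion below.
\<close>

definition holomorphic_map_on :: "(complex \<Rightarrow> complex ^ 'n) \<Rightarrow> complex set \<Rightarrow> bool" where
  "holomorphic_map_on F S \<longleftrightarrow> (\<forall>j. (\<lambda>w. F w $ j) holomorphic_on S)"

text \<open>
  A polynomial $P(w,x)$ is represented as a polynomial in $x$ (outer variable) whose coefficients
  are polynomials in $w$ (inner variable): evaluating at the constant polynomial \<open>[:x:]\<close> and then
  at \<open>w\<close> yields $P(w,x)$.
\<close>

definition algebraic_on :: "(complex \<Rightarrow> complex) \<Rightarrow> complex set \<Rightarrow> bool" where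
  "algebraic_on f S \<longleftrightarrow>
    (\<exists>P :: complex poly poly. P \<noteq> 0 \<and> (\<forall>w\<in>S. poly (poly P [:f w:]) w = 0))"

definition algebraic_map_on :: "(complex \<Rightarrow> complex ^ 'n) \<Rightarrow> complex set \<Rightarrow> bool" where
  "algebraic_map_on F S \<longleftrightarrow> (\<forall>j. algebraic_on (\<lambda>w. F w $ j) S)"

definition rational_on :: "(complex \<Rightarrow> complex) \<Rightarrow> complex set \<Rightarrow> bool" where
  "rational_on f S \<longleftrightarrow>
    (\<exists>p q :: complex poly. \<forall>w\<in>S. poly q w \<noteq> 0 \<and> f w = poly p w / poly q w)"

definition rational_map_on :: "(complex \<Rightarrow> complex ^ 'n) \<Rightarrow> complex set \<Rightarrow> bool" where
  "rational_map_on F S \<longleftrightarrow> (\<forall>j. rational_on (\<lambda>w. F w $ j) S)"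

text \<open>
  The library defines \<^const>\<open>proper_map\<close> through closed maps with compact fibres. For continuous
  maps into the ball this is the usual condition on preimages of compact sets.
\<close>

lemma proper_map_ball_iff:
  fixes F :: "complex \<Rightarrow> complex ^ 'n"
  assumes "continuous_on (ball 0 1) F" and "F ` ball 0 1 \<subseteq> ball 0 1"
  shows "proper_map (top_of_set (ball 0 1)) (top_of_set (ball 0 1)) F \<longleftrightarrow>
    (\<forall>K. compact K \<and> K \<subseteq> ball 0 1 \<longrightarrow> compact {w \<in> ball 0 1. F w \<in> K})"
proof
  assume proper: "proper_map (top_of_set (ball 0 1)) (top_of_set (ball 0 1)) F"
  show "\<forall>K. compact K \<and> K \<subseteq> ball 0 1 \<longrightarrow> compact {w \<in> ball 0 1. F w \<in> K}"
    using compactin_proper_map_preimage[OF proper] by (auto simp: compactin_subtopology)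
next
  assume preimage: "\<forall>K. compact K \<and> K \<subseteq> ball 0 1 \<longrightarrow> compact {w \<in> ball 0 1. F w \<in> K}"
  have metrizable: "metrizable_space (top_of_set (ball (0 :: complex ^ 'n) 1))"
    by (simp add: metrizable_space_euclidean metrizable_space_subtopology)
  show "proper_map (top_of_set (ball 0 1)) (top_of_set (ball 0 1)) F"
  proof (rule compact_imp_proper_map)
    show "k_space (top_of_set (ball (0 :: complex ^ 'n) 1))"
      using metrizable by (rule metrizable_imp_k_space)
    show "kc_space (top_of_set (ball (0 :: complex ^ 'n) 1))"
      by (simp add: Hausdorff_imp_kc_space Hausdorff_space_subtopology)
  qed (use assms preimage in \<open>auto simp: compactin_subtopology continuous_map_in_subtopology\<close>)
qed

end

theory Submission
  imports Defs "HOL-Computational_Algebra.Polynomial_Factorial" "HOL-Computational_Algebra.Field_as_Ring"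
begin

text \<open>
  Let $B(x) = (41x^2 - 9)/(41 - 9x^2)$, a Blaschke product of degree 2 that maps $|x| \le 2/5$
  into itself with $|B'| < 9/10$. For $|w| < 21/20$ let $x = \varphi(w)$ be the fixed point of
  $w B$ there, so that $w = \psi(x)$ with $\psi = x/B(x)$ a cubic quotient of Blaschke products. The
  Hermitian polynomial $|41x^2 - 9|^2 - |x|^2 |41 - 9x^2|^2$, which vanishes where $|w| = 1$, also
  vanishes on $|x| = 1$; the cofactor of $1 - |x|^2$ in it is the Bezoutian of the numerator
  and denominator of $\psi$, a Hermitian form of signature $(1,2)$ in $1, x, x^2$. Diagonalising the
  form gives
  $225 (|1 - x^2|^2 - |\frac45 (1 + x^2)|^2 - |\frac83 x|^2)$, hence
  $w \mapsto (\frac45 \frac{1+x^2}{1-x^2}, \frac83 \frac{x}{1-x^2})$ maps the disc properly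
  into the ball. The coefficients 41 and 9 make both $\frac45$ and $\frac83$ rational.

  If the first component were rational, $x^2$ would be a quotient $P/Q$ of coprime polynomials
  in $w$ with $P (41Q - 9P)^2 = w^2 Q (41P - 9Q)^2$. Divisibility makes $Q$ constant, degrees
  give $\deg P \le 2$, and then the coefficients of $w$, $w^2$ and $w^6$ are contradictory.
\<close>

section \<open>Bounds for the Blaschke product on |x| <= 2/5\<close>

lemma norm_quadratic_denom:
  fixes x :: complex
  assumes "norm x \<le> 2/5"
  shows "norm (41 - 9 * x\<^sup>2) \<ge> 989/25" "41 - 9 * x\<^sup>2 \<noteq> 0" "norm (x\<^sup>2) \<le> 4/25" "1 - x\<^sup>2 \<noteq> 0"
proof -
  have "norm x ^ 2 \<le> (2/5)^2" using assms by (intro power_mono) auto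
  then show s: "norm (x\<^sup>2) \<le> 4/25" by (simp add: norm_power power_divide)
  have "norm (41 :: complex) - norm (9 * x\<^sup>2) \<le> norm (41 - 9 * x\<^sup>2)" by (rule norm_triangle_ineq2)
  then show d: "norm (41 - 9 * x\<^sup>2) \<ge> 989/25" using s by (simp add: norm_mult)
  then show "41 - 9 * x\<^sup>2 \<noteq> 0" by (intro notI) simp
  show "1 - x\<^sup>2 \<noteq> 0" using s by (intro notI) simp
qed

definition blaschke :: "complex \<Rightarrow> complex" where
  "blaschke x = (41 * x\<^sup>2 - 9) / (41 - 9 * x\<^sup>2)"

text \<open>The divided difference of \<open>blaschke\<close>, with the factor x - y cancelled so
  that it also makes sense at x = y, where it is the derivative. The constant 1600 is 41^2 -
  9^2.\<close>

definition blaschke_slope :: "complex \<Rightarrow> complex \<Rightarrow> complex" where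
  "blaschke_slope x y = 1600 * (x + y) / ((41 - 9 * x\<^sup>2) * (41 - 9 * y\<^sup>2))"

text \<open>In terms of s = x^2, the squared inequality is affine in |s|^2 and Re s. The extreme
  case is s = -4/25, where the modulus is exactly 389/1061.\<close>

lemma norm_blaschke_le:
  assumes "norm x \<le> 2/5"
  shows "norm (blaschke x) \<le> 389/1061"
proof -
  define s where "s = x\<^sup>2"
  have s: "norm s \<le> 4/25" "41 - 9 * s \<noteq> 0"
    using norm_quadratic_denom[OF assms] by (auto simp: s_def)
  have R: "(Re s)^2 + (Im s)^2 \<le> (4/25)^2"
    using s(1) power_mono[OF s(1), of 2] by (simp add: cmod_power2)
  have "- Re s \<le> 4/25" using s(1) abs_Re_le_cmod[of s] by linarith
  have "(norm (1061 * (41 * s - 9)))^2 \<le> (norm (389 * (41 - 9 * s)))^2"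
    unfolding cmod_power2 using R \<open>- Re s \<le> 4/25\<close> by (simp add: power2_eq_square algebra_simps)
  then have "norm (1061 * (41 * s - 9)) \<le> norm (389 * (41 - 9 * s))"
    by (rule power2_le_imp_le) simp
  then have "1061 * norm (41 * s - 9) \<le> 389 * norm (41 - 9 * s)"
    unfolding norm_mult by simp
  then show ?thesis
    using s(2) by (simp add: blaschke_def s_def norm_divide divide_simps)
qed

lemma blaschke_diff:
  assumes "norm x \<le> 2/5" "norm y \<le> 2/5"
  shows "blaschke x - blaschke y = (x - y) * blaschke_slope x y"
proof -
  have "(41 * x\<^sup>2 - 9) * (41 - 9 * y\<^sup>2) - (41 * y\<^sup>2 - 9) * (41 - 9 * x\<^sup>2) = (x - y) * (1600 * (x + y))"
    by algebra
  then show ?thesis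
    using norm_quadratic_denom(2)[OF assms(1)] norm_quadratic_denom(2)[OF assms(2)]
    unfolding blaschke_def blaschke_slope_def by (simp add: diff_frac_eq)
qed

lemma norm_blaschke_slope_le:
  assumes "norm x \<le> 2/5" "norm y \<le> 2/5"
  shows "norm (blaschke_slope x y) \<le> 9/10"
proof -
  let ?d = "\<lambda>x::complex. 41 - 9 * x\<^sup>2"
  have "(989/25) * (989/25) \<le> norm (?d x) * norm (?d y)"
    using assms by (intro mult_mono norm_quadratic_denom(1)) auto
  moreover have "norm (x + y) \<le> 4/5" using assms norm_triangle_ineq[of x y] by linarith
  ultimately have "1600 * norm (x + y) \<le> 9/10 * (norm (?d x) * norm (?d y))" by simp
  then show ?thesis
    using norm_quadratic_denom(2)[OF assms(1)] norm_quadratic_denom(2)[OF assms(2)]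
    by (simp add: blaschke_slope_def norm_divide norm_mult divide_simps del: distrib_left_numeral)
qed

section \<open>The fixed point as a holomorphic function of w\<close>

lemma fixed_point_exists:
  assumes "norm w < 21/20"
  shows "\<exists>x. norm x \<le> 2/5 \<and> x = w * blaschke x"
proof -
  have "\<exists>!x. x \<in> cball 0 (2/5) \<and> w * blaschke x = x"
  proof (rule Banach_fix)
    show "complete (cball (0::complex) (2/5))" by (simp add: complete_eq_closed)
    show "cball (0::complex) (2/5) \<noteq> {}" by simp
    \<comment> \<open>189/200 = 21/20 * 9/10 bounds |w| times the slope. The disc is mapped into
      itself because 21/20 * 389/1061 < 2/5.\<close>
    show "(189/200::real) < 1" "(0::real) \<le> 189/200" by simp_all
    show "(\<lambda>x. w * blaschke x) ` cball 0 (2/5) \<subseteq> cball 0 (2/5)"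
    proof clarify
      fix x :: complex assume "x \<in> cball 0 (2/5)"
      then have "norm w * norm (blaschke x) \<le> 21/20 * (389/1061)"
        using assms by (intro mult_mono norm_blaschke_le) auto
      then show "w * blaschke x \<in> cball 0 (2/5)" by (simp add: norm_mult)
    qed
    fix x y :: complex assume xy: "x \<in> cball 0 (2/5)" "y \<in> cball 0 (2/5)"
    then have "norm w * norm (blaschke_slope x y) \<le> 21/20 * (9/10)"
      using assms by (intro mult_mono norm_blaschke_slope_le) auto
    then have "norm w * norm (blaschke_slope x y) * norm (x - y) \<le> 189/200 * norm (x - y)"
      by (intro mult_right_mono) auto
    moreover have "w * blaschke x - w * blaschke y = w * ((x - y) * blaschke_slope x y)"
      using blaschke_diff[of x y] xy by (simp add: right_diff_distrib[symmetric])
    ultimately show "dist (w * blaschke x) (w * blaschke y) \<le> 189/200 * dist x y"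
      by (simp add: dist_norm norm_mult mult_ac)
  qed
  then show ?thesis by (metis mem_cball_0)
qed

definition fixed_point :: "complex \<Rightarrow> complex" where
  "fixed_point w = (SOME x. norm x \<le> 2/5 \<and> x = w * blaschke x)"

lemma fixed_point:
  assumes "norm w < 21/20"
  shows "norm (fixed_point w) \<le> 2/5" "fixed_point w = w * blaschke (fixed_point w)"
  using someI_ex[OF fixed_point_exists[OF assms]] unfolding fixed_point_def by blast+

lemma fixed_point_equation:
  assumes "norm w < 21/20" and "x = fixed_point w"
  shows "x * (41 - 9 * x\<^sup>2) = w * (41 * x\<^sup>2 - 9)"
proof -
  have "w * blaschke x = x" "41 - 9 * x\<^sup>2 \<noteq> 0"
    using fixed_point[OF assms(1)] norm_quadratic_denom(2)[of x] assms(2) by metis+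
  then show ?thesis unfolding blaschke_def by (simp add: field_simps)
qed

text \<open>An exact form of implicit differentiation: x - y = (v - w) B(x) + w (B(x) - B(y)), and
  the divided difference turns the last term into a multiple of x - y. Both continuity and
  holomorphy of the fixed point are read off from this identity.\<close>

lemma fixed_point_diff:
  assumes "norm v < 21/20" "norm w < 21/20"
  shows "(fixed_point v - fixed_point w) * (1 - w * blaschke_slope (fixed_point v) (fixed_point w))
    = (v - w) * blaschke (fixed_point v)"
proof -
  define x y where "x = fixed_point v" and "y = fixed_point w"
  have "v * blaschke x = x" "w * blaschke y = y"
    using fixed_point(2)[OF assms(1)] fixed_point(2)[OF assms(2)] unfolding x_def y_def by metis+
  then have "x - y = (v - w) * blaschke x + w * (blaschke x - blaschke y)"
    by (simp add: algebra_simps)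
  also have "blaschke x - blaschke y = (x - y) * blaschke_slope x y"
    unfolding x_def y_def by (intro blaschke_diff fixed_point(1) assms)
  finally show ?thesis
    unfolding x_def[symmetric] y_def[symmetric] by (simp add: algebra_simps)
qed

lemma fixed_point_slope_ge:
  assumes "norm w < 21/20" "norm x \<le> 2/5" "norm y \<le> 2/5"
  shows "norm (1 - w * blaschke_slope x y) \<ge> 1/20"
proof -
  have "norm w * norm (blaschke_slope x y) \<le> 21/20 * (9/10)"
    using assms by (intro mult_mono norm_blaschke_slope_le) auto
  moreover have "norm (1::complex) - norm (w * blaschke_slope x y) \<le> norm (1 - w * blaschke_slope x y)"
    by (rule norm_triangle_ineq2)
  ultimately show ?thesis by (simp add: norm_mult)
qed

text \<open>In \<open>fixed_point_diff\<close> the cofactor of x - y has modulus at least 1/20, and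
  |B(x)| <= 1.\<close>

lemma fixed_point_lipschitz:
  assumes "norm v < 21/20" "norm w < 21/20"
  shows "norm (fixed_point v - fixed_point w) \<le> 20 * norm (v - w)"
proof -
  define x y where "x = fixed_point v" and "y = fixed_point w"
  have xy: "norm x \<le> 2/5" "norm y \<le> 2/5"
    unfolding x_def y_def by (intro fixed_point(1) assms)+
  have "norm (x - y) * (1/20) \<le> norm (x - y) * norm (1 - w * blaschke_slope x y)"
    by (intro mult_left_mono fixed_point_slope_ge assms xy) simp
  also have "\<dots> = norm (v - w) * norm (blaschke x)"
    using arg_cong[OF fixed_point_diff[OF assms], of norm] unfolding norm_mult x_def y_def .
  also have "\<dots> \<le> norm (v - w) * 1"
    using norm_blaschke_le[OF xy(1)] by (intro mult_left_mono) auto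
  finally show ?thesis by (simp add: x_def y_def)
qed

lemma continuous_on_fixed_point: "continuous_on (ball 0 (21/20)) fixed_point"
proof (rule lipschitz_on_continuous_on)
  show "20-lipschitz_on (ball 0 (21/20)) fixed_point"
    by (rule lipschitz_onI) (auto simp: dist_norm intro: fixed_point_lipschitz)
qed

text \<open>By \<open>fixed_point_diff\<close> the difference quotient at w is an explicit
  expression in \<open>fixed_point v\<close> whose denominator stays away from 0. Continuity of
  \<open>fixed_point\<close> then gives its limit as v tends to w.\<close>

lemma holomorphic_fixed_point: "fixed_point holomorphic_on ball 0 (21/20)"
  unfolding holomorphic_on_open[OF open_ball]
proof
  fix w :: complex assume w: "w \<in> ball 0 (21/20)"
  define y where "y = fixed_point w"
  have y: "norm y \<le> 2/5" using fixed_point(1) w by (auto simp: y_def)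
  have c: "(fixed_point \<longlongrightarrow> y) (at w)"
    using continuous_on_fixed_point w by (simp add: continuous_on_eq_continuous_at isCont_def y_def)
  have nz: "1 - w * blaschke_slope y y \<noteq> 0"
    using fixed_point_slope_ge[of w y y] w y by (intro notI) simp
  have "((\<lambda>v. blaschke (fixed_point v) / (1 - w * blaschke_slope (fixed_point v) y)) \<longlongrightarrow>
      blaschke y / (1 - w * blaschke_slope y y)) (at w)"
    unfolding blaschke_def blaschke_slope_def
    by (intro tendsto_intros c) (use norm_quadratic_denom(2)[OF y] nz in \<open>auto simp: blaschke_slope_def\<close>)
  moreover have "\<forall>\<^sub>F v in at w. blaschke (fixed_point v) / (1 - w * blaschke_slope (fixed_point v) y)
      = (fixed_point v - fixed_point w) / (v - w)"
    unfolding eventually_at_topological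
  proof (intro exI[of _ "ball 0 (21/20)"] conjI ballI impI w open_ball)
    fix v :: complex assume v: "v \<in> ball 0 (21/20)" "v \<noteq> w"
    have "1 - w * blaschke_slope (fixed_point v) y \<noteq> 0"
      using fixed_point_slope_ge[of w "fixed_point v" y] fixed_point(1)[of v] v w y by (intro notI) simp
    then show "blaschke (fixed_point v) / (1 - w * blaschke_slope (fixed_point v) y)
        = (fixed_point v - fixed_point w) / (v - w)"
      using fixed_point_diff[of v w] v w by (simp add: y_def frac_eq_eq mult_ac)
  qed
  ultimately show "\<exists>f'. (fixed_point has_field_derivative f') (at w)"
    unfolding has_field_derivative_iff by (blast intro: Lim_transform_eventually)
qed

section \<open>The two components and their norm\<close>

definition disc_fst :: "complex \<Rightarrow> complex" where
  "disc_fst w = 4 * (1 + (fixed_point w)\<^sup>2) / (5 * (1 - (fixed_point w)\<^sup>2))"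

definition disc_snd :: "complex \<Rightarrow> complex" where
  "disc_snd w = 8 * fixed_point w / (3 * (1 - (fixed_point w)\<^sup>2))"

lemma holomorphic_disc_fst: "disc_fst holomorphic_on ball 0 (21/20)"
  and holomorphic_disc_snd: "disc_snd holomorphic_on ball 0 (21/20)"
  unfolding disc_fst_def disc_snd_def
  by (intro holomorphic_intros holomorphic_fixed_point;
      use norm_quadratic_denom(4) fixed_point(1) in auto)+

text \<open>The assumption trades |w|^2 |41 x^2 - 9|^2 for |x|^2 |41 - 9 x^2|^2. What remains is a
  polynomial identity in Re x and Im x.\<close>

lemma norm_identity:
  fixes x w :: complex
  assumes "x * (41 - 9 * x\<^sup>2) = w * (41 * x\<^sup>2 - 9)"
  shows "225 * (1 - (norm x)\<^sup>2) * ((norm (1 - x\<^sup>2))\<^sup>2 - (norm (4/5 * (1 + x\<^sup>2)))\<^sup>2 - (norm (8/3 * x))\<^sup>2)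
    = (norm (41 * x\<^sup>2 - 9))\<^sup>2 * (1 - (norm w)\<^sup>2)"
proof -
  have "(norm (41 * x\<^sup>2 - 9))\<^sup>2 * (1 - (norm w)\<^sup>2)
      = (norm (41 * x\<^sup>2 - 9))\<^sup>2 - (norm (x * (41 - 9 * x\<^sup>2)))\<^sup>2"
    unfolding assms norm_mult power_mult_distrib by algebra
  also have "\<dots> = 225 * (1 - (norm x)\<^sup>2)
      * ((norm (1 - x\<^sup>2))\<^sup>2 - (norm (4/5 * (1 + x\<^sup>2)))\<^sup>2 - (norm (8/3 * x))\<^sup>2)"
    unfolding cmod_power2 by (simp add: power2_eq_square) (simp add: field_simps)
  finally show ?thesis by simp
qed

text \<open>Since k > 0 on a disc reaching beyond |w| = 1, this one identity sends the open unit
  disc into the ball and the unit circle into the sphere.\<close>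

lemma disc_norm_identity:
  assumes "norm w < 21/20"
  shows "\<exists>k>0. 1 - ((norm (disc_fst w))\<^sup>2 + (norm (disc_snd w))\<^sup>2) = k * (1 - (norm w)\<^sup>2)"
proof -
  define x where "x = fixed_point w"
  have x: "norm x \<le> 2/5" using fixed_point(1)[OF assms] by (simp add: x_def)
  have eq: "x * (41 - 9 * x\<^sup>2) = w * (41 * x\<^sup>2 - 9)"
    using fixed_point_equation[OF assms x_def] .
  note nz = norm_quadratic_denom[OF x]
  \<comment> \<open>Otherwise \<open>eq\<close> forces x = 0, where this expression is -9.\<close>
  have "41 * x\<^sup>2 - 9 \<noteq> 0" using eq nz by auto
  have "(norm x)\<^sup>2 \<le> 4/25" using nz(3) by (simp add: norm_power)
  define D c where "D = (norm (1 - x\<^sup>2))\<^sup>2" and "c = 225 * (1 - (norm x)\<^sup>2)"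
  have pos: "D > 0" "c > 0" using nz(4) \<open>(norm x)\<^sup>2 \<le> 4/25\<close> by (auto simp: D_def c_def)
  have "1 - ((norm (disc_fst w))\<^sup>2 + (norm (disc_snd w))\<^sup>2)
      = (D - (norm (4/5 * (1 + x\<^sup>2)))\<^sup>2 - (norm (8/3 * x))\<^sup>2) / D"
    using pos unfolding disc_fst_def disc_snd_def x_def[symmetric] norm_divide norm_mult
    by (simp add: power_divide power_mult_distrib D_def[symmetric] field_simps)
  also have "\<dots> = c * (D - (norm (4/5 * (1 + x\<^sup>2)))\<^sup>2 - (norm (8/3 * x))\<^sup>2) / (c * D)"
    using pos by simp
  also have "\<dots> = (norm (41 * x\<^sup>2 - 9))\<^sup>2 / (c * D) * (1 - (norm w)\<^sup>2)"
    using norm_identity[OF eq] unfolding D_def[symmetric] c_def[symmetric] by simp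
  finally show ?thesis
    using pos \<open>41 * x\<^sup>2 - 9 \<noteq> 0\<close> by (intro exI[of _ "(norm (41 * x\<^sup>2 - 9))\<^sup>2 / (c * D)"]) auto
qed

section \<open>Polynomial equations for the two components\<close>

lemma disc_fst_equation:
  assumes "norm w < 21/20" and X: "X = disc_fst w"
  shows "(5 * X - 4) * (4 * X + 5)\<^sup>2 = w\<^sup>2 * (5 * X + 4) * (4 * X - 5)\<^sup>2"
proof -
  define x s where "x = fixed_point w" and "s = x\<^sup>2"
  have "s \<noteq> 1"
    using norm_quadratic_denom(4)[of x] fixed_point(1)[OF assms(1)] by (auto simp: x_def s_def)
  \<comment> \<open>X is a Moebius transform of s, so each linear form in X is a linear form in s
    divided by 1 - s. These four produce s, 1 and the two factors of the fixed point
    equation.\<close>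
  then have factors: "5 * X - 4 = 8 * s / (1 - s)" "5 * X + 4 = 8 / (1 - s)"
    "4 * X + 5 = (41 - 9 * s) / (5 * (1 - s))" "4 * X - 5 = (41 * s - 9) / (5 * (1 - s))"
    unfolding X disc_fst_def x_def[symmetric] s_def[symmetric]
    by (auto simp: divide_simps)
  \<comment> \<open>Squaring leaves only s = x^2, on which alone X depends.\<close>
  have "(x * (41 - 9 * s))\<^sup>2 = (w * (41 * s - 9))\<^sup>2"
    using fixed_point_equation[OF assms(1) x_def] by (simp add: s_def)
  then have "s * (41 - 9 * s)\<^sup>2 = w\<^sup>2 * (41 * s - 9)\<^sup>2"
    by (simp add: power_mult_distrib s_def)
  then show ?thesis
    unfolding factors power_divide by simp
qed

text \<open>The two components lie on the conic 25 X^2 = 16 + 9 Y^2, because (1 + x^2)^2 = (1 -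
  x^2)^2 + 4 x^2. Hence an equation in X^2 and w turns into one in Y^2 and w.\<close>

lemma disc_snd_equation:
  assumes "norm w < 21/20" and Y: "Y = disc_snd w"
  shows "(1 - w\<^sup>2)\<^sup>2 * (16 + 9 * Y\<^sup>2) * (9 + 16 * Y\<^sup>2)\<^sup>2 = 16 * (1 + w\<^sup>2)\<^sup>2 * (34 * Y\<^sup>2 - 9)\<^sup>2"
proof -
  define x X where "x = fixed_point w" and "X = disc_fst w"
  have nz: "1 - x\<^sup>2 \<noteq> 0"
    using norm_quadratic_denom(4)[of x] fixed_point(1)[OF assms(1)] by (auto simp: x_def)
  define d where "d = 1 - x\<^sup>2"
  have "25 * X\<^sup>2 = (4 * (1 + x\<^sup>2))\<^sup>2 / d\<^sup>2"
    unfolding X_def disc_fst_def x_def[symmetric] d_def[symmetric]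
    by (simp add: power_divide power_mult_distrib)
  also have "(4 * (1 + x\<^sup>2))\<^sup>2 = 16 * d\<^sup>2 + (8 * x)\<^sup>2"
    by (simp add: d_def power2_eq_square algebra_simps)
  also have "(16 * d\<^sup>2 + (8 * x)\<^sup>2) / d\<^sup>2 = 16 + (8 * x)\<^sup>2 / d\<^sup>2"
    using nz by (simp add: add_divide_distrib d_def)
  also have "(8 * x)\<^sup>2 / d\<^sup>2 = 9 * Y\<^sup>2"
    unfolding Y disc_snd_def x_def[symmetric] d_def[symmetric]
    by (simp add: power_divide power_mult_distrib)
  finally have X2: "X\<^sup>2 = (16 + 9 * Y\<^sup>2) / 25"
    by (simp add: eq_divide_eq mult.commute)
  have X4: "80 * X\<^sup>2 - 35 = 9/5 * (9 + 16 * Y\<^sup>2)"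
    "100 - 136 * X\<^sup>2 = -36/25 * (34 * Y\<^sup>2 - 9)"
    unfolding X2 by (simp_all add: field_simps)
  \<comment> \<open>Separate the odd and even powers of \<open>X\<close>: squaring then leaves an equation in \<open>X\<^sup>2\<close>.\<close>
  have "X * (80 * X\<^sup>2 - 35) * (1 - w\<^sup>2) - (100 - 136 * X\<^sup>2) * (1 + w\<^sup>2)
      = (5 * X - 4) * (4 * X + 5)\<^sup>2 - w\<^sup>2 * (5 * X + 4) * (4 * X - 5)\<^sup>2"
    by (simp add: power2_eq_square algebra_simps)
  then have "X * (80 * X\<^sup>2 - 35) * (1 - w\<^sup>2) = (100 - 136 * X\<^sup>2) * (1 + w\<^sup>2)"
    unfolding disc_fst_equation[OF assms(1) X_def] by simp
  then have "(X * (80 * X\<^sup>2 - 35) * (1 - w\<^sup>2))\<^sup>2 = ((100 - 136 * X\<^sup>2) * (1 + w\<^sup>2))\<^sup>2"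
    by simp
  \<comment> \<open>The factor is 1/25 * (9/5)^2 on the left; on the right (36/25)^2 = 16 *
    81/625.\<close>
  then have "(81/625) * ((1 - w\<^sup>2)\<^sup>2 * (16 + 9 * Y\<^sup>2) * (9 + 16 * Y\<^sup>2)\<^sup>2)
      = (81/625) * (16 * (1 + w\<^sup>2)\<^sup>2 * (34 * Y\<^sup>2 - 9)\<^sup>2)"
    unfolding X4 unfolding power_mult_distrib X2 by (simp add: power_divide mult_ac)
  then show ?thesis by (simp add: mult.assoc)
qed

lemma algebraic_on_disc_fst: "algebraic_on disc_fst (ball 0 1)"
  unfolding algebraic_on_def
proof (intro exI conjI ballI)
  define X :: "complex poly poly" where "X = [:0, 1:]"
  define W :: "complex poly poly" where "W = [:[:0, 0, 1:]:]"
  define P where "P = (5 * X - 4) * (4 * X + 5)\<^sup>2 - W * (5 * X + 4) * (4 * X - 5)\<^sup>2"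
  have eval: "poly (poly P [:x:]) w
      = (5 * x - 4) * (4 * x + 5)\<^sup>2 - w\<^sup>2 * (5 * x + 4) * (4 * x - 5)\<^sup>2" for x w
    by (simp add: P_def X_def W_def power2_eq_square mult_ac)
  show "P \<noteq> 0" using eval[of 0 0] by auto
  fix w :: complex assume "w \<in> ball 0 1"
  then show "poly (poly P [:disc_fst w:]) w = 0"
    using disc_fst_equation[of w, OF _ refl] by (simp add: eval)
qed

lemma algebraic_on_disc_snd: "algebraic_on disc_snd (ball 0 1)"
  unfolding algebraic_on_def
proof (intro exI conjI ballI)
  define Y :: "complex poly poly" where "Y = [:0, 0, 1:]"
  define W :: "complex poly poly" where "W = [:[:0, 0, 1:]:]"
  define P where "P = (1 - W)\<^sup>2 * (16 + 9 * Y) * (9 + 16 * Y)\<^sup>2 - 16 * (1 + W)\<^sup>2 * (34 * Y - 9)\<^sup>2"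
  have eval: "poly (poly P [:y:]) w = (1 - w\<^sup>2)\<^sup>2 * (16 + 9 * y\<^sup>2) * (9 + 16 * y\<^sup>2)\<^sup>2
      - 16 * (1 + w\<^sup>2)\<^sup>2 * (34 * y\<^sup>2 - 9)\<^sup>2" for y w
    by (simp add: P_def Y_def W_def power2_eq_square) (simp only: mult_ac)
  \<comment> \<open>At y = 0, w = 0 the two terms cancel; at y = 0, w = 1 only the second
    survives.\<close>
  show "P \<noteq> 0" using eval[of 0 1] by auto
  fix w :: complex assume "w \<in> ball 0 1"
  then show "poly (poly P [:disc_snd w:]) w = 0"
    using disc_snd_equation[of w, OF _ refl] by (simp add: eval)
qed

lemma algebraic_on_zero: "algebraic_on (\<lambda>w. 0) S"
  unfolding algebraic_on_def by (rule exI[of _ "[:0, 1:]"]) simp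

section \<open>Non-rationality of the first component\<close>

lemma poly_eq_on_ball:
  fixes p q :: "complex poly"
  assumes "\<And>w. w \<in> ball 0 1 \<Longrightarrow> poly p w = poly q w"
  shows "p = q"
proof (rule ccontr)
  assume "p \<noteq> q"
  then have "finite {w. poly (p - q) w = 0}" by (intro poly_roots_finite) simp
  moreover have "ball 0 1 \<subseteq> {w. poly (p - q) w = 0}" using assms by auto
  ultimately have "finite (ball (0::complex) 1)" by (rule finite_subset[rotated])
  then show False using uncountable_ball[of 1 "0::complex"] by (simp add: countable_finite)
qed

lemma rational_on_coprime:
  assumes "rational_on f S" "S \<noteq> {}"
  obtains p q :: "complex poly"
  where "coprime p q" "\<And>w. w \<in> S \<Longrightarrow> poly q w \<noteq> 0 \<and> f w = poly p w / poly q w"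
proof -
  obtain p q where pq: "\<And>w. w \<in> S \<Longrightarrow> poly q w \<noteq> 0 \<and> f w = poly p w / poly q w"
    using assms(1) by (auto simp: rational_on_def)
  have "gcd p q \<noteq> 0" using pq assms(2) by auto
  then obtain p' q' where d: "p = p' * gcd p q" "q = q' * gcd p q" "coprime p' q'"
    using gcd_coprime_exists by blast
  have "poly q' w \<noteq> 0 \<and> f w = poly p' w / poly q' w" if "w \<in> S" for w
  proof -
    have "poly p w = poly p' w * poly (gcd p q) w" "poly q w = poly q' w * poly (gcd p q) w"
      using d(1,2) by (metis poly_mult)+
    then show ?thesis using pq[OF that] by auto
  qed
  with d(3) show ?thesis by (rule that)
qed

text \<open>A / B stands for x^2 as a function of w, and the equation is the squared fixed point
  equation with denominators cleared. \<open>A0\<close> records that x = 0 at w = 0.\<close>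

lemma no_coprime_solution:
  fixes A B :: "complex poly"
  assumes "coprime A B" and A0: "poly A 0 = 0" and "B \<noteq> 0"
    and eq: "A * (41 * B - 9 * A)\<^sup>2 = [:0, 0, 1:] * B * (41 * A - 9 * B)\<^sup>2"
  shows False
proof -
  \<comment> \<open>Modulo B the left side is 81 A^3, so B divides A^3, and coprimality makes B a
    unit.\<close>
  have "B dvd A * (41 * B - 9 * A)\<^sup>2" unfolding eq by (simp only: dvd_mult2 dvd_triv_right)
  moreover have "A * (41 * B - 9 * A)\<^sup>2 = B * (A * (1681 * B - 738 * A)) + 81 * A ^ 3"
    by (simp add: power2_eq_square power3_eq_cube algebra_simps)
  ultimately have "B dvd 81 * A ^ 3" by (simp add: dvd_add_right_iff)
  then have "B dvd smult 81 (A ^ 3)" by (simp add: numeral_poly)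
  then have "B dvd A ^ 3" by (simp add: dvd_smult_iff)
  then have "is_unit B"
    using assms(1) by (metis coprime_commute coprime_power_right_iff coprime_absorb_left)
  then obtain k where "B = [:k:]" by (auto simp: is_unit_poly_iff)
  with \<open>B \<noteq> 0\<close> have k: "B = [:k:]" "k \<noteq> 0" by auto
  have B: "degree (41 * B) = 0" "degree (9 * B) = 0" using k by (simp_all add: numeral_poly)
  \<comment> \<open>With B constant and n = deg A > 2, the degrees 3n and 2 + 2n of the two sides
    differ.\<close>
  have "degree A \<le> 2"
  proof (rule ccontr)
    assume n: "\<not> degree A \<le> 2"
    have deg: "degree (c * A) = degree A" if "c = 41 \<or> c = 9" for c
      using that by (auto simp: numeral_poly)
    have "degree (41 * B - 9 * A) = degree A"
      using n B degree_add_eq_right[of "41 * B" "- (9 * A)"] deg by simp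
    moreover have "degree (41 * A - 9 * B) = degree A"
      using n B degree_add_eq_left[of "- (9 * B)" "41 * A"] deg by simp
    moreover have "A \<noteq> 0" "41 * B - 9 * A \<noteq> 0" "41 * A - 9 * B \<noteq> 0" using n calculation by auto
    ultimately have "degree (A * (41 * B - 9 * A)\<^sup>2) = 3 * degree A"
      "degree ([:0, 0, 1:] * B * (41 * A - 9 * B)\<^sup>2) = 2 + 2 * degree A"
      using \<open>B \<noteq> 0\<close> by (simp_all add: degree_mult_eq degree_power_eq k(1))
    then show False using eq n by simp
  qed
  have "coeff A 0 = 0" using A0 by (simp add: poly_0_coeff_0)
  define a b where "a = coeff A 1" and "b = coeff A 2"
  have A: "A = [:0, a, b:]"
    using \<open>degree A \<le> 2\<close> \<open>coeff A 0 = 0\<close>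
    by (auto simp: poly_eq_iff a_def b_def coeff_pCons coeff_eq_0 numeral_2_eq_2 split: nat.split)
  have eq': "[:0, a, b:] * ([:41 * k, -9 * a, -9 * b:])\<^sup>2
      = [:0, 0, 1:] * [:k:] * ([:-9 * k, 41 * a, 41 * b:])\<^sup>2"
    using eq unfolding A k(1) by (simp add: numeral_poly mult.commute)
  have "coeff ([:0, a, b:] * ([:41 * k, -9 * a, -9 * b:])\<^sup>2) 1 = 1681 * a * k\<^sup>2"
    by (simp add: power2_eq_square)
  moreover have "coeff ([:0, 0, 1:] * [:k:] * ([:-9 * k, 41 * a, 41 * b:])\<^sup>2) 1 = 0"
    by (simp add: power2_eq_square)
  ultimately have a: "a = 0" using k(2) unfolding eq' by simp
  \<comment> \<open>The coefficients of w^2 and w^6. For b nonzero they would give both b/k =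
    81/1681 and b/k = 1681/81.\<close>
  have "1681 * b * k\<^sup>2 = 81 * k ^ 3" "81 * b ^ 3 = 1681 * k * b\<^sup>2"
    using eq' by (simp_all add: a power2_eq_square power3_eq_cube)
  then have k_eq: "1681 * b = 81 * k" and "b = 0 \<or> 81 * b = 1681 * k"
    using k(2) by (auto simp: power2_eq_square power3_eq_cube)
  then have "b = 0 \<or> 81 * (81 * b) = 1681 * (1681 * b)" by auto
  then have "b = 0" by auto
  then show False using k(2) k_eq by simp
qed

lemma disc_fst_zero: "disc_fst 0 = 4/5"
  using fixed_point(2)[of 0] by (simp add: disc_fst_def)

lemma not_rational_on_disc_fst: "\<not> rational_on disc_fst (ball 0 1)"
proof
  assume "rational_on disc_fst (ball 0 1)"
  then obtain p q where "coprime p q"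
    and pq: "\<And>w. w \<in> ball 0 1 \<Longrightarrow> poly q w \<noteq> 0 \<and> disc_fst w = poly p w / poly q w"
    by (rule rational_on_coprime) auto
  \<comment> \<open>Inverting the Moebius map from x^2 to X = p / q gives x^2 = (5 X - 4) / (5 X +
    4) = A / B.\<close>
  define A B where "A = 5 * p - 4 * q" and "B = 5 * p + 4 * q"
  have q0: "poly q 0 \<noteq> 0" and "poly p 0 / poly q 0 = 4/5"
    using pq[of 0] disc_fst_zero by auto
  then have "poly p 0 = 4/5 * poly q 0" by (metis nonzero_eq_divide_eq)
  then have p0: "5 * poly p 0 = 4 * poly q 0" by (simp add: mult.commute)
  show False
  proof (rule no_coprime_solution)
    show "poly A 0 = 0" using p0 by (simp add: A_def)
    show "B \<noteq> 0"
    proof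
      assume "B = 0"
      then have "poly B 0 = 0" by simp
      then show False using p0 q0 by (simp add: B_def)
    qed
    show "coprime A B"
    proof (rule coprimeI)
      fix c assume c: "c dvd A" "c dvd B"
      have "smult 10 p = A + B" "smult 8 q = B - A"
        by (simp_all add: A_def B_def numeral_poly smult_add_left[symmetric])
      then have "c dvd smult 10 p" "c dvd smult 8 q" using c by auto
      then have "c dvd p" "c dvd q" by (simp_all add: dvd_smult_iff)
      with \<open>coprime p q\<close> show "is_unit c" by (rule coprime_common_divisor)
    qed
    show "A * (41 * B - 9 * A)\<^sup>2 = [:0, 0, 1:] * B * (41 * A - 9 * B)\<^sup>2"
    proof (rule poly_eq_on_ball)
      fix w :: complex assume w: "w \<in> ball 0 1"
      define P Q where "P = poly p w" and "Q = poly q w"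
      have "Q \<noteq> 0" using pq[OF w] by (simp add: Q_def)
      then have factors: "5 * (P/Q) - 4 = (5 * P - 4 * Q) / Q" "5 * (P/Q) + 4 = (5 * P + 4 * Q) / Q"
        "4 * (P/Q) + 5 = (4 * P + 5 * Q) / Q" "4 * (P/Q) - 5 = (4 * P - 5 * Q) / Q"
        by (simp_all add: diff_divide_distrib add_divide_distrib)
      have "(5 * (P/Q) - 4) * (4 * (P/Q) + 5)\<^sup>2 = w\<^sup>2 * (5 * (P/Q) + 4) * (4 * (P/Q) - 5)\<^sup>2"
        using disc_fst_equation[of w, OF _ refl] w pq[OF w] by (simp add: P_def Q_def)
      then have "Q = 0 \<or> (5 * P - 4 * Q) * (4 * P + 5 * Q)\<^sup>2
          = w\<^sup>2 * (5 * P + 4 * Q) * (4 * P - 5 * Q)\<^sup>2"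
        unfolding factors power_divide by simp
      with \<open>Q \<noteq> 0\<close> have "(5 * P - 4 * Q) * (4 * P + 5 * Q)\<^sup>2
          = w\<^sup>2 * (5 * P + 4 * Q) * (4 * P - 5 * Q)\<^sup>2"
        by blast
      \<comment> \<open>The 40 matches 41 B - 9 A = 40 (4 p + 5 q) and 41 A - 9 B = 40 (4 p - 5
        q).\<close>
      then have "(5 * P - 4 * Q) * (40 * (4 * P + 5 * Q))\<^sup>2
          = w\<^sup>2 * (5 * P + 4 * Q) * (40 * (4 * P - 5 * Q))\<^sup>2"
        unfolding power_mult_distrib by (simp only: mult.left_commute[of _ "40\<^sup>2"])
      moreover have "poly A w = 5 * P - 4 * Q" "poly B w = 5 * P + 4 * Q"
        "poly (41 * B - 9 * A) w = 40 * (4 * P + 5 * Q)"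
        "poly (41 * A - 9 * B) w = 40 * (4 * P - 5 * Q)" "poly [:0, 0, 1:] w = w\<^sup>2"
        by (simp_all add: A_def B_def P_def Q_def power2_eq_square)
      ultimately show "poly (A * (41 * B - 9 * A)\<^sup>2) w = poly ([:0, 0, 1:] * B * (41 * A - 9 * B)\<^sup>2) w"
        unfolding poly_mult poly_power by (simp only:)
    qed
  qed
qed

section \<open>Assembling the map into the N-dimensional ball\<close>

theorem proposition24:
  assumes "CARD('n::finite) \<ge> 2"
  shows "\<exists>F :: complex \<Rightarrow> complex ^ 'n.
    F ` ball 0 1 \<subseteq> ball 0 1 \<and>
    holomorphic_map_on F (ball 0 1) \<and>
    proper_map (top_of_set (ball 0 1)) (top_of_set (ball 0 1)) F \<and>
    algebraic_map_on F (ball 0 1) \<and>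
    \<not> rational_map_on F (ball 0 1) \<and>
    (\<exists>U G. open U \<and> cball 0 1 \<subseteq> U \<and> holomorphic_map_on G U \<and>
      (\<forall>w\<in>ball 0 1. G w = F w))"
proof -
  obtain i j :: 'n where "i \<noteq> j"
    using assms by (auto simp: numeral_2_eq_2 card_le_Suc_iff)
  define F :: "complex \<Rightarrow> complex ^ 'n" where
    "F w = (\<chi> k. if k = i then disc_fst w else if k = j then disc_snd w else 0)" for w
  have F_cases: "(\<lambda>w. F w $ k) \<in> {disc_fst, disc_snd, \<lambda>w. 0}" for k
    by (cases "k = i"; cases "k = j") (simp_all add: F_def)
  have F_i: "(\<lambda>w. F w $ i) = disc_fst" by (simp add: F_def)
  have norm_F: "(norm (F w))\<^sup>2 = (norm (disc_fst w))\<^sup>2 + (norm (disc_snd w))\<^sup>2" for w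
  proof -
    have "(norm (F w))\<^sup>2 = (\<Sum>k\<in>UNIV. (norm (F w $ k))\<^sup>2)"
      by (simp add: norm_vec_def L2_set_def sum_nonneg)
    also have "\<dots> = (\<Sum>k\<in>{i, j}. (norm (F w $ k))\<^sup>2)"
      by (rule sum.mono_neutral_right) (auto simp: F_def)
    finally show ?thesis using \<open>i \<noteq> j\<close> by (simp add: F_def)
  qed
  have norm_F_less_iff: "norm (F w) < 1 \<longleftrightarrow> norm w < 1" if "norm w < 21/20" for w
  proof -
    obtain k where "k > 0" "1 - (norm (F w))\<^sup>2 = k * (1 - (norm w)\<^sup>2)"
      using disc_norm_identity[of w] \<open>norm w < 21/20\<close> unfolding norm_F by blast
    then have "(norm (F w))\<^sup>2 < 1 \<longleftrightarrow> (norm w)\<^sup>2 < 1"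
      by (smt (verit) zero_less_mult_iff)
    then show ?thesis by (simp add: power_less_one_iff abs_square_less_1)
  qed
  have hol: "holomorphic_map_on F (ball 0 (21/20))"
    unfolding holomorphic_map_on_def
  proof
    show "(\<lambda>w. F w $ k) holomorphic_on ball 0 (21/20)" for k
      using F_cases[of k] holomorphic_disc_fst holomorphic_disc_snd by auto
  qed
  have sub: "cball 0 1 \<subseteq> ball (0::complex) (21/20)" by auto
  have cont: "continuous_on (ball 0 (21/20)) F"
  proof -
    have "continuous_on (ball 0 (21/20)) (\<lambda>w. \<chi> k. F w $ k)"
      using hol unfolding holomorphic_map_on_def
      by (intro continuous_on_vec_lambda holomorphic_on_imp_continuous_on) auto
    then show ?thesis by simp
  qed
  have into: "F ` ball 0 1 \<subseteq> ball 0 1" using norm_F_less_iff by auto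
  have "proper_map (top_of_set (ball 0 1)) (top_of_set (ball 0 1)) F"
  proof (subst proper_map_ball_iff[OF _ into])
    show "continuous_on (ball 0 1) F" using cont by (rule continuous_on_subset) auto
    show "\<forall>K. compact K \<and> K \<subseteq> ball 0 1 \<longrightarrow> compact {w \<in> ball 0 1. F w \<in> K}"
    proof clarify
      fix K :: "(complex ^ 'n) set" assume K: "compact K" "K \<subseteq> ball 0 1"
      \<comment> \<open>Points of the unit circle are mapped outside the open ball, hence outside K.
        Adding the circle therefore does not change the preimage, which becomes closed in a compact
        disc.\<close>
      have "{w \<in> ball 0 1. F w \<in> K} = cball 0 1 \<inter> F -` K"
        using K(2) norm_F_less_iff by (force simp: subset_iff)
      moreover have "closed (cball 0 1 \<inter> F -` K)"
        using continuous_on_subset[OF cont sub] K(1)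
        by (intro continuous_closed_preimage) (auto intro: compact_imp_closed)
      ultimately show "compact {w \<in> ball 0 1. F w \<in> K}"
        using compact_Int_closed[OF compact_cball[of 0 1]] by (metis Int_left_absorb)
    qed
  qed
  moreover have "holomorphic_map_on F (ball 0 1)"
    using hol unfolding holomorphic_map_on_def by (meson holomorphic_on_subset sub ball_subset_cball)
  moreover have "algebraic_map_on F (ball 0 1)"
    unfolding algebraic_map_on_def
  proof
    show "algebraic_on (\<lambda>w. F w $ k) (ball 0 1)" for k
      using F_cases[of k] algebraic_on_disc_fst algebraic_on_disc_snd algebraic_on_zero by auto
  qed
  moreover have "\<not> rational_map_on F (ball 0 1)"
    using not_rational_on_disc_fst F_i unfolding rational_map_on_def by metis
  ultimately show ?thesis
    \<comment> \<open>The extension is \<open>F\<close> itself, already holomorphic on the disc of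
      radius 21/20.\<close>
    using into hol sub by (intro exI[of _ F] conjI exI[of _ "ball 0 (21/20)"]) auto
qed

end
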